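(* Let $\Gamma_+$ and $\Gamma_-$ be tournaments on a set $J$ of size $n$. Let $I_+ = J \times \{+1\}$, $I_- = J \times \{-1\}$ and $I = \{0\}\cup I_-\cup I_+$. There exists a pointed game $\Pi$ on the pair $(I_+,I_-)$ such that with the identification $j\mapsto(j,-1)$, $\Pi_- = \Gamma_-$, and with the identification $j\mapsto(j,+1)$, $\Pi_+=\Gamma_+$.
   Context: A tournament on a finite set $I$ is a relation $\Pi\subset I\times I$ without loops such that for distinct $i,j$ exactly one of $(i,j),(j,i)$ is in $\Pi$. $\Pi(i)=\{j:(i,j)\in\Pi\}$, $\Pi^{-1}(i)=\{j:(j,i)\in\Pi\}$. A game on a set $I$ of size $2n+1$ is a tournament with $|\Pi(i)|=|\Pi^{-1}(i)|=n$ for all $i\in I$. A pointed game on the pair $(I_+,I_-)$ is a game $\Pi$ on $I=\{0\}\cup I_+\cup I_-$ (disjoint union) with $\Pi(0)=I_-$ and $\Pi^{-1}(0)=I_+$. $\Pi_\pm$ denotes the tournament $\Pi\cap(I_\pm\times I_\pm)$ on $I_\pm$. *)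

theory Defs
  imports Main
begin

text \<open>For a relation \<open>P\<close>, the paper's sets \<open>P(i)\<close> and \<open>P\<inverse>(i)\<close> (successors and predecessors of \<open>i\<close>)
  are the relational images \<open>P `` {i}\<close> and \<open>P\<inverse> `` {i}\<close>.\<close>

definition tournament_on :: "'a set \<Rightarrow> 'a rel \<Rightarrow> bool" where
  "tournament_on I P \<longleftrightarrow>
     finite I \<and> P \<subseteq> I \<times> I \<and> irrefl P \<and>
     (\<forall>i\<in>I. \<forall>j\<in>I. i \<noteq> j \<longrightarrow> ((i, j) \<in> P) \<noteq> ((j, i) \<in> P))"

definition game_on :: "'a set \<Rightarrow> 'a rel \<Rightarrow> bool" where
  "game_on I P \<longleftrightarrow>
     tournament_on I P \<and>
     (\<exists>n. card I = 2 * n + 1 \<and> (\<forall>i\<in>I. card (P `` {i}) = n \<and> card (P\<inverse> `` {i}) = n))"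

text \<open>The parameter \<open>z\<close> is the distinguished point, called \<open>0\<close> in the paper.\<close>

definition pointed_game_on :: "'a \<Rightarrow> 'a set \<Rightarrow> 'a set \<Rightarrow> 'a rel \<Rightarrow> bool" where
  "pointed_game_on z Iplus Iminus P \<longleftrightarrow>
     z \<notin> Iplus \<and> z \<notin> Iminus \<and> Iplus \<inter> Iminus = {} \<and>
     game_on ({z} \<union> Iplus \<union> Iminus) P \<and>
     P `` {z} = Iminus \<and> P\<inverse> `` {z} = Iplus"

definition restrict_rel :: "'a rel \<Rightarrow> 'a set \<Rightarrow> 'a rel" where
  "restrict_rel P A = P \<inter> (A \<times> A)"

text \<open>The disjoint union \<open>{0} \<union> J \<times> {-1} \<union> J \<times> {+1}\<close> lives in the type \<open>('a \<times> int) option\<close>: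
  the point \<open>0\<close> is \<open>None\<close>, and \<open>(j, s)\<close> is \<open>Some (j, s)\<close>.\<close>

definition signed_copy :: "int \<Rightarrow> 'a \<Rightarrow> ('a \<times> int) option" where
  "signed_copy s j = Some (j, s)"

end

theory Submission
  imports Defs
begin

text \<open>Each vertex \<open>(i, +1)\<close> already beats \<open>0\<close> and its \<open>\<Gamma>p\<close>-successors, so it must beat exactly
  as many \<open>(j, -1)\<close> as \<open>i\<close> has \<open>\<Gamma>p\<close>-predecessors; dually, \<open>(j, -1)\<close> must lose to exactly as many
  \<open>(i, +1)\<close> as \<open>j\<close> has \<open>\<Gamma>m\<close>-successors. A bipartite relation with these degrees exists by the
  Gale--Ryser theorem. If its cut condition failed for row and column sets of sizes \<open>u\<close> and \<open>s\<close>,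
  Landau's inequality for scores of tournaments would give \<open>(s - u)\<^sup>2 < s - u\<close>.\<close>

section \<open>Bipartite relations with prescribed degrees\<close>

text \<open>An arc of the exchange digraph on columns: with \<open>R\<close> viewed as a 0-1 matrix,
  some row can move an entry from column \<open>x\<close> to column \<open>y\<close> without
  changing its row sum.\<close>

definition exchangeable :: "('a \<times> 'b) set \<Rightarrow> 'b \<Rightarrow> 'b \<Rightarrow> bool" where
  "exchangeable R x y \<longleftrightarrow> (\<exists>i. (i, x) \<in> R \<and> (i, y) \<notin> R)"

text \<open>Prepending a vertex breaks distinctness only if it already occurs; dropping everything
  before that occurrence repairs the path. Distinctness later lets the exchanges along the path be
  carried out one after another.\<close>

lemma rtranclp_distinct_path:
  assumes "r\<^sup>*\<^sup>* x y"
  shows "\<exists>xs. successively r (x # xs) \<and> distinct (x # xs) \<and> last (x # xs) = y"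
  using assms
proof (induction rule: converse_rtranclp_induct)
  case base
  show ?case by (intro exI[of _ "[]"]) simp
next
  case (step x z)
  then obtain xs where xs: "successively r (z # xs)" "distinct (z # xs)" "last (z # xs) = y"
    by blast
  show ?case
  proof (cases "x \<in> set (z # xs)")
    case True
    then obtain us vs where uv: "z # xs = us @ x # vs"
      by (meson split_list)
    show ?thesis
      using xs unfolding uv by (intro exI[of _ vs]) (auto simp: successively_append_iff)
  next
    case False
    show ?thesis
      using xs step.hyps(1) False by (intro exI[of _ "z # xs"]) auto
  qed
qed

text \<open>Each arc moves one entry to the next column within its row, so every inner column loses
  one and gains one. Column sums are compared as integers so that the loss is not truncated; for
  \<open>xs = []\<close> the two corrections cancel.\<close>

lemma augment_along_path:
  fixes R :: "('a \<times> 'b) set"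
  assumes "finite A" "finite B" "R \<subseteq> A \<times> B"
    and "successively (exchangeable R) (x # xs)" "distinct (x # xs)" "set (x # xs) \<subseteq> B"
  shows "\<exists>R'\<subseteq>A \<times> B. (\<forall>i. card (R' `` {i}) = card (R `` {i})) \<and>
     (\<forall>l. int (card (R'\<inverse> `` {l})) = int (card (R\<inverse> `` {l}))
            - (if l = x then 1 else 0) + (if l = last (x # xs) then 1 else 0))"
  using assms(3-)
proof (induction xs arbitrary: x R)
  case Nil
  then show ?case by (intro exI[of _ R]) auto
next
  case (Cons y ys)
  have fin: "finite R"
    using Cons.prems(1) assms(1,2) finite_subset by blast
  from Cons.prems obtain i where i: "(i, x) \<in> R" "(i, y) \<notin> R"
    unfolding exchangeable_def by auto
  have xy: "x \<noteq> y" using Cons.prems by auto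
  \<comment> \<open>The exchange for the first arc; the induction hypothesis is applied to
    \<open>Q\<close> and the rest of the path, hence the generalisation over
    \<open>R\<close>.\<close>
  define Q where "Q = insert (i, y) (R - {(i, x)})"
  have Q: "Q \<subseteq> A \<times> B" using Cons.prems i unfolding Q_def by auto
  have rows: "card (Q `` {k}) = card (R `` {k})" for k
  proof (cases "k = i")
    case True
    have "Q `` {i} = insert y (R `` {i} - {x})" using i xy unfolding Q_def by auto
    moreover have "card (insert y (R `` {i} - {x})) = card (R `` {i})"
      using i xy fin card_Suc_Diff1[of "R `` {i}" x] by (subst card_insert_disjoint) auto
    ultimately show ?thesis using True by simp
  next
    case False
    then have "Q `` {k} = R `` {k}" unfolding Q_def by auto
    then show ?thesis by simp
  qed
  have cols: "int (card (Q\<inverse> `` {l})) = int (card (R\<inverse> `` {l}))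
      - (if l = x then 1 else 0) + (if l = y then 1 else 0)" for l
  proof -
    consider "l = x" | "l = y" | "l \<noteq> x" "l \<noteq> y" by blast
    then show ?thesis
    proof cases
      case 1
      have "Q\<inverse> `` {x} = R\<inverse> `` {x} - {i}" using xy unfolding Q_def by auto
      moreover have "i \<in> R\<inverse> `` {x}" "finite (R\<inverse> `` {x})" using i fin by auto
      ultimately have "Suc (card (Q\<inverse> `` {x})) = card (R\<inverse> `` {x})"
        by (simp only: card_Suc_Diff1)
      then show ?thesis using 1 xy by simp
    next
      case 2
      have "Q\<inverse> `` {y} = insert i (R\<inverse> `` {y})" using xy unfolding Q_def by auto
      moreover have "i \<notin> R\<inverse> `` {y}" "finite (R\<inverse> `` {y})" using i fin by auto
      ultimately show ?thesis using 2 xy by simp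
    next
      case 3
      then have "Q\<inverse> `` {l} = R\<inverse> `` {l}" unfolding Q_def by auto
      then show ?thesis using 3 by simp
    qed
  qed
  \<comment> \<open>The exchange only touches columns \<open>x\<close> and \<open>y\<close>; it enlarges column \<open>y\<close>, which is the source
    of the next step, and \<open>x\<close> does not occur again.\<close>
  have keep: "exchangeable Q a b" if "exchangeable R a b" "a \<noteq> x" "b \<noteq> y" for a b
    using that unfolding exchangeable_def Q_def by auto
  have mono: "successively (exchangeable Q) (a # zs)"
    if "successively (exchangeable R) (a # zs)" "x \<notin> set (a # zs)" "y \<notin> set zs" for a zs
    using that by (induction zs arbitrary: a) (auto intro: keep)
  have "successively (exchangeable Q) (y # ys)"
    using Cons.prems by (intro mono) auto
  then obtain R' where R': "R' \<subseteq> A \<times> B" "\<forall>i. card (R' `` {i}) = card (Q `` {i})"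
    "\<forall>l. int (card (R'\<inverse> `` {l})) = int (card (Q\<inverse> `` {l}))
            - (if l = y then 1 else 0) + (if l = last (y # ys) then 1 else 0)"
    using Cons.IH[of Q y] Q Cons.prems by auto
  then show ?case
    using rows cols by (intro exI[of _ R']) auto
qed

lemma card_eq_sum_Image:
  assumes "finite A" "finite B" "R \<subseteq> A \<times> B"
  shows "card R = (\<Sum>i\<in>A. card (R `` {i}))"
proof -
  have "R = (SIGMA i:A. R `` {i})" using assms(3) by auto
  moreover have "\<forall>i\<in>A. finite (R `` {i})"
    using assms finite_subset[OF _ assms(2)] by blast
  ultimately show ?thesis using card_SigmaI[of A "\<lambda>i. R `` {i}"] assms(1) by simp
qed

lemma card_eq_sum_converse_Image:
  assumes "finite A" "finite B" "R \<subseteq> A \<times> B"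
  shows "card R = (\<Sum>j\<in>B. card (R\<inverse> `` {j}))"
proof -
  have "card (R\<inverse>) = card R" by (rule card_inverse)
  moreover have "R\<inverse> \<subseteq> B \<times> A" using assms(3) by auto
  ultimately show ?thesis using card_eq_sum_Image[OF assms(2,1), of "R\<inverse>"] by simp
qed

text \<open>The cut condition is the obvious necessary bound: rows in \<open>U\<close> have at most
  \<open>card U * card (B - S)\<close> entries outside \<open>S\<close>, and the columns of
  \<open>S\<close> hold only \<open>sum c S\<close>. For sufficiency, the row sums are kept exact
  and the column surplus is minimised; a remaining surplus exposes a violated cut.\<close>

theorem gale_ryser:
  fixes A :: "'a set" and B :: "'b set" and r :: "'a \<Rightarrow> nat" and c :: "'b \<Rightarrow> nat"
  assumes fin: "finite A" "finite B" and total: "sum r A = sum c B"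
    and cut: "\<And>U S. U \<subseteq> A \<Longrightarrow> S \<subseteq> B \<Longrightarrow> sum r U \<le> card U * card (B - S) + sum c S"
  shows "\<exists>R\<subseteq>A \<times> B. (\<forall>i\<in>A. card (R `` {i}) = r i) \<and> (\<forall>j\<in>B. card (R\<inverse> `` {j}) = c j)"
proof -
  define admissible where "admissible R \<longleftrightarrow> R \<subseteq> A \<times> B \<and> (\<forall>i\<in>A. card (R `` {i}) = r i)" for R
  \<comment> \<open>Truncated subtraction counts only the surplus over \<open>c\<close>; deficient
    columns contribute 0.\<close>
  define excess where "excess R = (\<Sum>j\<in>B. card (R\<inverse> `` {j}) - c j)" for R :: "('a \<times> 'b) set"
  have "\<forall>i\<in>A. \<exists>T\<subseteq>B. card T = r i"
  proof
    fix i assume "i \<in> A"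
    \<comment> \<open>The cut for a single row and no columns is what makes a starting relation with
      the right row sums possible.\<close>
    then have "r i \<le> card B" using cut[of "{i}" "{}"] by simp
    then show "\<exists>T\<subseteq>B. card T = r i" by (meson obtain_subset_with_card_n)
  qed
  then obtain T where T: "\<And>i. i \<in> A \<Longrightarrow> T i \<subseteq> B \<and> card (T i) = r i" by metis
  have "Sigma A T `` {i} = T i" if "i \<in> A" for i using that by auto
  then have "admissible (Sigma A T)" using T unfolding admissible_def by auto
  then obtain R where R: "admissible R" and min: "\<And>R'. admissible R' \<Longrightarrow> excess R \<le> excess R'"
    using ex_has_least_nat[of admissible "Sigma A T" excess] by auto
  have RAB: "R \<subseteq> A \<times> B" using R unfolding admissible_def by blast
  have finR: "finite R" using finite_subset[OF RAB] fin by simp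
  let ?d = "\<lambda>j. card (R\<inverse> `` {j})"
  have sum_d: "sum ?d B = sum c B"
    using card_eq_sum_Image[OF fin RAB] card_eq_sum_converse_Image[OF fin RAB] R total
    unfolding admissible_def by simp
  have le: "?d j \<le> c j" if j: "j \<in> B" for j
  proof (rule ccontr)
    assume "\<not> ?d j \<le> c j"
    then have big: "c j < ?d j" by simp
    \<comment> \<open>The columns reachable from the overfull column \<open>j\<close> by exchanges
      that stay inside \<open>B\<close>.\<close>
    define S where "S = {k \<in> B. (\<lambda>x y. exchangeable R x y \<and> y \<in> B)\<^sup>*\<^sup>* j k}"
    have jS: "j \<in> S" using j unfolding S_def by simp
    have SB: "S \<subseteq> B" unfolding S_def by auto
    \<comment> \<open>A deficient reachable column could absorb one surplus entry of
      \<open>j\<close> along a path, contradicting minimality.\<close>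
    have ge: "c k \<le> ?d k" if k: "k \<in> S" for k
    proof (rule ccontr)
      assume "\<not> c k \<le> ?d k"
      then have small: "?d k < c k" by simp
      then have jk: "j \<noteq> k" using big by auto
      have "(\<lambda>x y. exchangeable R x y \<and> y \<in> B)\<^sup>*\<^sup>* j k" using k unfolding S_def by simp
      from rtranclp_distinct_path[OF this] obtain xs where
        xs: "successively (\<lambda>x y. exchangeable R x y \<and> y \<in> B) (j # xs)"
          "distinct (j # xs)" "last (j # xs) = k"
        by (elim exE conjE)
      have inB: "set ys \<subseteq> B"
        if "successively (\<lambda>x y. exchangeable R x y \<and> y \<in> B) (x # ys)" for x ys
        using that by (induction ys arbitrary: x) auto
      have "successively (exchangeable R) (j # xs)"
        using xs(1) by (rule successively_mono) auto
      then obtain R' where R': "R' \<subseteq> A \<times> B" "\<And>i. card (R' `` {i}) = card (R `` {i})"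
        "\<And>l. int (card (R'\<inverse> `` {l})) = int (?d l)
            - (if l = j then 1 else 0) + (if l = k then 1 else 0)"
        using augment_along_path[OF fin RAB, of j xs] xs(2,3) inB[OF xs(1)] j by auto
      have "admissible R'" using R R'(1,2) unfolding admissible_def by auto
      moreover have "excess R' < excess R"
        unfolding excess_def
      proof (rule sum_strict_mono_ex1[OF fin(2)])
        \<comment> \<open>Column \<open>k\<close> gains an entry, but it was below
          \<open>c k\<close>, so its truncated term stays 0.\<close>
        show "\<forall>l\<in>B. card (R'\<inverse> `` {l}) - c l \<le> ?d l - c l"
        proof
          fix l
          show "card (R'\<inverse> `` {l}) - c l \<le> ?d l - c l"
            using R'(3)[of l] small by (auto split: if_splits)
        qed
        have "card (R'\<inverse> `` {j}) - c j < ?d j - c j"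
          using R'(3)[of j] jk big by auto
        then show "\<exists>l\<in>B. card (R'\<inverse> `` {l}) - c l < ?d l - c l" using j by blast
      qed
      ultimately show False using min[of R'] by simp
    qed
    \<comment> \<open>The rows that meet \<open>S\<close>. Since no exchange leads out of
      \<open>S\<close>, each of them contains all of \<open>B - S\<close>, so the cut bound for
      \<open>U\<close> and \<open>S\<close> is attained with the actual column sums in place of
      \<open>c\<close>.\<close>
    define U where "U = R\<inverse> `` S"
    have UA: "U \<subseteq> A" using RAB unfolding U_def by auto
    have finU: "finite U" and finS: "finite S" using UA SB fin finite_subset by auto
    have full: "B - S \<subseteq> R `` {i}" if "i \<in> U" for i
    proof
      fix t assume t: "t \<in> B - S"
      from that obtain s where s: "s \<in> S" "(i, s) \<in> R" unfolding U_def by auto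
      have "\<not> exchangeable R s t"
      proof
        assume "exchangeable R s t"
        then have "t \<in> S" using s t unfolding S_def by (auto intro: rtranclp.rtrancl_into_rtrancl)
        then show False using t by simp
      qed
      then show "t \<in> R `` {i}" using s unfolding exchangeable_def by auto
    qed
    have "sum r U = (\<Sum>i\<in>U. card (B - S) + card ((R \<inter> U \<times> S) `` {i}))"
    proof (rule sum.cong[OF refl])
      fix i assume i: "i \<in> U"
      have "R `` {i} = (B - S) \<union> (R \<inter> U \<times> S) `` {i}" using full[OF i] i RAB by auto
      moreover have "(B - S) \<inter> (R \<inter> U \<times> S) `` {i} = {}" by auto
      moreover have "finite ((R \<inter> U \<times> S) `` {i})" using finR by auto
      ultimately have "card (R `` {i}) = card (B - S) + card ((R \<inter> U \<times> S) `` {i})"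
        using card_Un_disjoint[of "B - S"] fin by simp
      then show "r i = card (B - S) + card ((R \<inter> U \<times> S) `` {i})"
        using R UA i unfolding admissible_def by auto
    qed
    also have "\<dots> = card U * card (B - S) + card (R \<inter> U \<times> S)"
      using card_eq_sum_Image[OF finU finS, of "R \<inter> U \<times> S"] by (simp add: sum.distrib)
    also have "card (R \<inter> U \<times> S) = (\<Sum>k\<in>S. card ((R \<inter> U \<times> S)\<inverse> `` {k}))"
      using card_eq_sum_converse_Image[OF finU finS] by simp
    also have "\<dots> = sum ?d S"
    proof (rule sum.cong[OF refl])
      fix k assume "k \<in> S"
      then have "(R \<inter> U \<times> S)\<inverse> `` {k} = R\<inverse> `` {k}" unfolding U_def by auto
      then show "card ((R \<inter> U \<times> S)\<inverse> `` {k}) = ?d k" by simp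
    qed
    finally have "sum r U = card U * card (B - S) + sum ?d S" .
    moreover have "sum c S < sum ?d S"
      using ge jS big by (intro sum_strict_mono_ex1[OF finS]) auto
    ultimately show False using cut[OF UA SB] by simp
  qed
  \<comment> \<open>No column is overfull and the totals agree, so none can be deficient.\<close>
  have "?d j = c j" if j: "j \<in> B" for j
    using sum_strict_mono_ex1[OF fin(2), of ?d c] le sum_d j by (metis nat_less_le)
  then show ?thesis using R unfolding admissible_def by auto
qed

section \<open>Scores of tournaments\<close>

lemma tournament_on_flip_iff:
  assumes "tournament_on J P" "i \<in> J" "j \<in> J" "i \<noteq> j"
  shows "(i, j) \<in> P \<longleftrightarrow> (j, i) \<notin> P"
proof -
  have "((i, j) \<in> P) \<noteq> ((j, i) \<in> P)"
    using assms unfolding tournament_on_def by blast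
  then show ?thesis by argo
qed

text \<open>Every vertex other than \<open>i\<close> is either a successor or a predecessor of
  \<open>i\<close>, never both; \<open>Suc\<close> accounts for \<open>i\<close> itself.\<close>

lemma tournament_on_degrees:
  assumes "tournament_on J P" "i \<in> J"
  shows "Suc (card (P `` {i}) + card (P\<inverse> `` {i})) = card J"
proof -
  have J: "finite J" "P \<subseteq> J \<times> J" using assms unfolding tournament_on_def by auto
  then have "P `` {i} \<subseteq> J" "P\<inverse> `` {i} \<subseteq> J" by auto
  then have fin: "finite (P `` {i})" "finite (P\<inverse> `` {i})"
    using J(1) finite_subset by auto
  have notin: "i \<notin> P `` {i} \<union> P\<inverse> `` {i}"
    using assms(1) unfolding tournament_on_def irrefl_def by auto
  have one: "(i, j) \<in> P \<longleftrightarrow> (j, i) \<notin> P" if "j \<in> J" "j \<noteq> i" for j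
    using tournament_on_flip_iff[OF assms that(1)] that(2) by simp
  have inJ: "j \<in> J" if "(i, j) \<in> P \<or> (j, i) \<in> P" for j
    using that J(2) by blast
  have eq: "J = insert i (P `` {i} \<union> P\<inverse> `` {i})"
  proof (rule set_eqI)
    fix j
    show "j \<in> J \<longleftrightarrow> j \<in> insert i (P `` {i} \<union> P\<inverse> `` {i})"
      unfolding insert_iff Un_iff Image_singleton_iff converse_iff
      using one[of j] inJ[of j] assms(2) by blast
  qed
  have disj: "P `` {i} \<inter> P\<inverse> `` {i} = {}"
  proof (rule equals0I)
    fix j assume "j \<in> P `` {i} \<inter> P\<inverse> `` {i}"
    then have "(i, j) \<in> P" "(j, i) \<in> P" by simp_all
    then show False using one[of j] inJ[of j] notin by (cases "j = i") simp_all
  qed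
  have "card J = card (insert i (P `` {i} \<union> P\<inverse> `` {i}))"
    using eq by (rule arg_cong)
  also have "\<dots> = Suc (card (P `` {i}) + card (P\<inverse> `` {i}))"
    using fin notin disj by (simp add: card_Un_disjoint)
  finally show ?thesis by simp
qed

text \<open>Out- and in-degree add up to \<open>card J - 1\<close> at each vertex, and both degree
  totals count the arcs. Doubling avoids division, and integers avoid truncation at empty
  \<open>J\<close>.\<close>

lemma tournament_on_sum_scores:
  assumes "tournament_on J P"
  shows "2 * (\<Sum>i\<in>J. int (card (P `` {i}))) = int (card J) * (int (card J) - 1)"
proof -
  have J: "finite J" "P \<subseteq> J \<times> J" using assms unfolding tournament_on_def by auto
  have "int (card (P `` {i})) + int (card (P\<inverse> `` {i})) = int (card J) - 1" if "i \<in> J" for i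
    using tournament_on_degrees[OF assms that] by simp
  then have "(\<Sum>i\<in>J. int (card (P `` {i})) + int (card (P\<inverse> `` {i}))) = int (card J) * (int (card J) - 1)"
    by simp
  moreover have "(\<Sum>i\<in>J. card (P\<inverse> `` {i})) = (\<Sum>i\<in>J. card (P `` {i}))"
    using card_eq_sum_Image[OF J(1,1,2)] card_eq_sum_converse_Image[OF J(1,1,2)] by simp
  then have "(\<Sum>i\<in>J. int (card (P\<inverse> `` {i}))) = (\<Sum>i\<in>J. int (card (P `` {i})))"
    by (metis of_nat_sum)
  ultimately show ?thesis by (simp add: sum.distrib)
qed

text \<open>The arcs inside \<open>S\<close> form a tournament with known score total, and restoring
  the other arcs of \<open>P\<close> can only raise scores.\<close>

lemma landau_inequality:
  assumes "tournament_on J P" "S \<subseteq> J"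
  shows "int (card S) * (int (card S) - 1) \<le> 2 * (\<Sum>i\<in>S. int (card (P `` {i})))"
proof -
  have J: "finite J" "P \<subseteq> J \<times> J" using assms unfolding tournament_on_def by auto
  have "tournament_on S (restrict_rel P S)"
    using assms finite_subset unfolding tournament_on_def restrict_rel_def irrefl_def by blast
  note tournament_on_sum_scores[OF this, symmetric]
  also have "(\<Sum>i\<in>S. int (card (restrict_rel P S `` {i}))) \<le> (\<Sum>i\<in>S. int (card (P `` {i})))"
  proof (rule sum_mono)
    fix i
    have "finite (P `` {i})" using J finite_subset[OF _ J(1)] by blast
    then show "int (card (restrict_rel P S `` {i})) \<le> int (card (P `` {i}))"
      unfolding restrict_rel_def by (auto intro!: card_mono)
  qed
  finally show ?thesis by simp
qed

text \<open>\<open>R\<close> will supply the arcs from the positive copy of \<open>J\<close>,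
  carrying \<open>P\<close>, to the negative copy, carrying \<open>Q\<close>; its degrees are those
  that make the glued tournament regular.\<close>

lemma cross_relation_exists:
  assumes P: "tournament_on J P" and Q: "tournament_on J Q"
  shows "\<exists>R\<subseteq>J \<times> J. (\<forall>i\<in>J. card (R `` {i}) = card (P\<inverse> `` {i})) \<and>
    (\<forall>j\<in>J. card (R\<inverse> `` {j}) = card (Q `` {j}))"
proof (rule gale_ryser)
  show fin: "finite J" "finite J" using P unfolding tournament_on_def by auto
  have indeg: "int (card (P\<inverse> `` {i})) = (int (card J) - 1) - int (card (P `` {i}))"
    if "i \<in> J" for i
    using tournament_on_degrees[OF P that] by simp
  have sum_indeg: "(\<Sum>i\<in>U. int (card (P\<inverse> `` {i})))
      = int (card U) * (int (card J) - 1) - (\<Sum>i\<in>U. int (card (P `` {i})))" if "U \<subseteq> J" for U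
    using indeg that by (simp add: subset_iff sum_subtractf)
  \<comment> \<open>Both doubled totals equal \<open>card J * (card J - 1)\<close>, independently of
    the tournament.\<close>
  have "2 * (\<Sum>i\<in>J. int (card (P\<inverse> `` {i}))) = 2 * (\<Sum>j\<in>J. int (card (Q `` {j})))"
    using sum_indeg[of J] tournament_on_sum_scores[OF P] tournament_on_sum_scores[OF Q]
    by (simp add: right_diff_distrib)
  then have "int (\<Sum>i\<in>J. card (P\<inverse> `` {i})) = int (\<Sum>j\<in>J. card (Q `` {j}))" by simp
  then show "(\<Sum>i\<in>J. card (P\<inverse> `` {i})) = (\<Sum>j\<in>J. card (Q `` {j}))" by (simp only: of_nat_eq_iff)
  fix U S assume U: "U \<subseteq> J" and S: "S \<subseteq> J"
  define u where "u = int (card U)"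
  define s where "s = int (card S)"
  define m where "m = int (card J)"
  \<comment> \<open>Integers satisfy \<open>t \<le> t * t\<close>. For \<open>t = s - u\<close> this
    expands to the doubled cut inequality with Landau's bounds substituted for both score
    sums.\<close>
  have "(s - u) * 1 \<le> (s - u) * (s - u)"
    by (cases "s - u \<le> 0") (auto intro: mult_left_mono order.trans[OF _ zero_le_square])
  then have "2 * (u * (m - 1)) - u * (u - 1) \<le> 2 * (u * (m - s)) + s * (s - 1)"
    by (simp add: algebra_simps)
  moreover have "u * (u - 1) \<le> 2 * (\<Sum>i\<in>U. int (card (P `` {i})))"
    using landau_inequality[OF P U] unfolding u_def .
  moreover have "s * (s - 1) \<le> 2 * (\<Sum>j\<in>S. int (card (Q `` {j})))"
    using landau_inequality[OF Q S] unfolding s_def .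
  moreover have "int (card (J - S)) = m - s"
    using S fin card_mono[OF fin(1) S] finite_subset[OF S fin(1)]
    unfolding m_def s_def by (simp add: card_Diff_subset of_nat_diff)
  ultimately have "(\<Sum>i\<in>U. int (card (P\<inverse> `` {i})))
      \<le> u * int (card (J - S)) + (\<Sum>j\<in>S. int (card (Q `` {j})))"
    using sum_indeg[OF U] unfolding u_def[symmetric] m_def[symmetric] by simp
  then have "int (\<Sum>i\<in>U. card (P\<inverse> `` {i})) \<le> int (card U * card (J - S) + (\<Sum>j\<in>S. card (Q `` {j})))"
    unfolding u_def by simp
  then show "(\<Sum>i\<in>U. card (P\<inverse> `` {i})) \<le> card U * card (J - S) + (\<Sum>j\<in>S. card (Q `` {j}))"
    by (simp only: of_nat_le_iff)
qed

section \<open>Gluing the two tournaments\<close>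

lemma signed_copy_simps [simp]:
  "signed_copy s i = signed_copy t j \<longleftrightarrow> s = t \<and> i = j"
  "signed_copy s i \<noteq> None" "None \<noteq> signed_copy s i"
  by (auto simp: signed_copy_def)

lemma signed_copy_image_iff [simp]:
  "signed_copy s i \<in> signed_copy t ` X \<longleftrightarrow> s = t \<and> i \<in> X"
  "None \<notin> signed_copy t ` X"
  by auto

lemma map_prod_signed_copy_iff [simp]:
  "(signed_copy s i, signed_copy t j) \<in> map_prod (signed_copy s') (signed_copy t') ` X
     \<longleftrightarrow> s = s' \<and> t = t' \<and> (i, j) \<in> X"
  "(None, x) \<notin> map_prod (signed_copy s') (signed_copy t') ` X"
  "(x, None) \<notin> map_prod (signed_copy s') (signed_copy t') ` X"
  by force+

lemma card_signed_copies:
  assumes "finite X" "finite Y"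
  shows "card (signed_copy 1 ` X \<union> signed_copy (-1) ` Y) = card X + card Y"
proof -
  have "inj_on (signed_copy s) Z" for s :: int and Z :: "'a set"
    by (auto simp: inj_on_def)
  then show ?thesis
    using assms by (subst card_Un_disjoint) (auto simp: card_image)
qed

theorem theorem7p4:
  fixes J :: "'a set" and n :: nat
    and \<Gamma>p \<Gamma>m :: "'a rel"
    and Iplus Iminus :: "('a \<times> int) option set"
  assumes "finite J" and "card J = n"
    and "tournament_on J \<Gamma>p" and "tournament_on J \<Gamma>m"
    and "Iplus = Some ` (J \<times> {1})" and "Iminus = Some ` (J \<times> {-1})"
  shows "\<exists>\<Pi>. pointed_game_on None Iplus Iminus \<Pi> \<and>
           restrict_rel \<Pi> Iminus = map_prod (signed_copy (-1)) (signed_copy (-1)) ` \<Gamma>m \<and>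
           restrict_rel \<Pi> Iplus = map_prod (signed_copy 1) (signed_copy 1) ` \<Gamma>p"
proof -
  obtain R where R: "R \<subseteq> J \<times> J"
    and rows: "\<And>i. i \<in> J \<Longrightarrow> card (R `` {i}) = card (\<Gamma>p\<inverse> `` {i})"
    and cols: "\<And>j. j \<in> J \<Longrightarrow> card (R\<inverse> `` {j}) = card (\<Gamma>m `` {j})"
    using cross_relation_exists[OF assms(3,4)] by blast
  have GJ: "\<Gamma>p \<subseteq> J \<times> J" "\<Gamma>m \<subseteq> J \<times> J"
    using assms(3,4) unfolding tournament_on_def by auto
  have Ip: "Iplus = signed_copy 1 ` J" and Im: "Iminus = signed_copy (-1) ` J"
    using assms(5,6) by (auto simp: signed_copy_def)
  \<comment> \<open>Arcs at \<open>None\<close> are dictated by pointedness. Taking the complement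
    of \<open>R\<inverse>\<close> for the arcs from negative to positive orients each cross pair
    exactly once, including the two copies of the same element.\<close>
  define \<Pi> where "\<Pi> = {None} \<times> Iminus \<union> Iplus \<times> {None}
    \<union> map_prod (signed_copy (-1)) (signed_copy (-1)) ` \<Gamma>m
    \<union> map_prod (signed_copy 1) (signed_copy 1) ` \<Gamma>p
    \<union> map_prod (signed_copy 1) (signed_copy (-1)) ` R
    \<union> map_prod (signed_copy (-1)) (signed_copy 1) ` (J \<times> J - R\<inverse>)"
  have mem:
    "(signed_copy 1 i, signed_copy 1 k) \<in> \<Pi> \<longleftrightarrow> (i, k) \<in> \<Gamma>p"
    "(signed_copy (-1) i, signed_copy (-1) k) \<in> \<Pi> \<longleftrightarrow> (i, k) \<in> \<Gamma>m"
    "(signed_copy 1 i, signed_copy (-1) k) \<in> \<Pi> \<longleftrightarrow> (i, k) \<in> R"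
    "(signed_copy (-1) i, signed_copy 1 k) \<in> \<Pi> \<longleftrightarrow> i \<in> J \<and> k \<in> J \<and> (k, i) \<notin> R"
    "(None, signed_copy 1 k) \<notin> \<Pi>" "(None, None) \<notin> \<Pi>" "(signed_copy (-1) i, None) \<notin> \<Pi>"
    "(None, signed_copy (-1) k) \<in> \<Pi> \<longleftrightarrow> k \<in> J"
    "(signed_copy 1 i, None) \<in> \<Pi> \<longleftrightarrow> i \<in> J" for i k
    unfolding \<Pi>_def Ip Im by simp_all
  let ?I = "{None} \<union> Iplus \<union> Iminus"
  have sub: "\<Pi> \<subseteq> ?I \<times> ?I" using GJ R unfolding \<Pi>_def Ip Im by auto
  have vertex_cases: "x = None \<or> (\<exists>i\<in>J. x = signed_copy 1 i) \<or> (\<exists>i\<in>J. x = signed_copy (-1) i)"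
    if "x \<in> ?I" for x
    using that unfolding Ip Im by auto
  \<comment> \<open>Extensionality split by kind of vertex, so that neighbourhoods can be computed
    by rewriting with \<open>mem\<close>.\<close>
  have eqI: "X = Y" if "X \<subseteq> ?I" "Y \<subseteq> ?I" "None \<in> X \<longleftrightarrow> None \<in> Y"
    "\<And>i. i \<in> J \<Longrightarrow> signed_copy 1 i \<in> X \<longleftrightarrow> signed_copy 1 i \<in> Y"
    "\<And>i. i \<in> J \<Longrightarrow> signed_copy (-1) i \<in> X \<longleftrightarrow> signed_copy (-1) i \<in> Y" for X Y
  proof (rule set_eqI)
    fix x
    show "x \<in> X \<longleftrightarrow> x \<in> Y" using that vertex_cases[of x] by auto
  qed
  have finI: "finite (Q `` {i})" "finite (Q\<inverse> `` {i})" if "Q \<subseteq> J \<times> J" for Q i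
  proof -
    have "Q `` {i} \<subseteq> J" "Q\<inverse> `` {i} \<subseteq> J" using that by auto
    then show "finite (Q `` {i})" "finite (Q\<inverse> `` {i})"
      using finite_subset assms(1) by auto
  qed
  note fins = finI[OF R] finI[OF GJ(1)] finI[OF GJ(2)]
  have out0: "\<Pi> `` {None} = Iminus" and in0: "\<Pi>\<inverse> `` {None} = Iplus"
    by (rule eqI; use sub in \<open>auto simp: mem Ip Im\<close>)+
  have cards: "card Iplus = n" "card Iminus = n"
    using card_signed_copies[of J "{}"] card_signed_copies[of "{}" J] assms(1,2)
    unfolding Ip Im by auto
  \<comment> \<open>The arc to \<open>None\<close>, the out-degree of \<open>i\<close> in
    \<open>\<Gamma>p\<close>, and its in-degree, which is the row sum of \<open>R\<close>, together
    count all of \<open>J\<close>.\<close>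
  have outp: "card (\<Pi> `` {signed_copy 1 i}) = n" if i: "i \<in> J" for i
  proof -
    have "\<Pi> `` {signed_copy 1 i}
        = insert None (signed_copy 1 ` (\<Gamma>p `` {i}) \<union> signed_copy (-1) ` (R `` {i}))"
      by (rule eqI) (use sub GJ R i in \<open>auto simp: mem Ip Im\<close>)
    moreover have "None \<notin> signed_copy 1 ` (\<Gamma>p `` {i}) \<union> signed_copy (-1) ` (R `` {i})"
      by auto
    ultimately show ?thesis
      using tournament_on_degrees[OF assms(3) i] rows[OF i] assms(2) fins
      by (simp add: card_signed_copies)
  qed
  have inp: "card (\<Pi>\<inverse> `` {signed_copy 1 i}) = n" if i: "i \<in> J" for i
  proof -
    have "\<Pi>\<inverse> `` {signed_copy 1 i}
        = signed_copy 1 ` (\<Gamma>p\<inverse> `` {i}) \<union> signed_copy (-1) ` (J - R `` {i})"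
      by (rule eqI) (use sub GJ R i in \<open>auto simp: mem Ip Im\<close>)
    \<comment> \<open>The row sum subtracted here cancels the in-degree of \<open>i\<close> in
      \<open>\<Gamma>p\<close>; the bound by \<open>card J\<close> keeps the natural subtraction
      exact.\<close>
    moreover have "card (J - R `` {i}) = card J - card (R `` {i})" "card (R `` {i}) \<le> card J"
      using R fins assms(1) by (auto intro!: card_Diff_subset card_mono)
    ultimately show ?thesis
      using rows[OF i] assms(1,2) fins by (simp add: card_signed_copies)
  qed
  \<comment> \<open>Dually, the column sum of \<open>R\<close> removed from \<open>J\<close> is the
    out-degree of \<open>j\<close> in \<open>\<Gamma>m\<close>, which the negative copy adds
    back.\<close>
  have outm: "card (\<Pi> `` {signed_copy (-1) j}) = n" if j: "j \<in> J" for j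
  proof -
    have "\<Pi> `` {signed_copy (-1) j}
        = signed_copy 1 ` (J - R\<inverse> `` {j}) \<union> signed_copy (-1) ` (\<Gamma>m `` {j})"
      by (rule eqI) (use sub GJ R j in \<open>auto simp: mem Ip Im\<close>)
    moreover have "card (J - R\<inverse> `` {j}) = card J - card (R\<inverse> `` {j})" "card (R\<inverse> `` {j}) \<le> card J"
      using R fins assms(1) by (auto intro!: card_Diff_subset card_mono)
    ultimately show ?thesis
      using cols[OF j] assms(1,2) fins by (simp add: card_signed_copies)
  qed
  have inm: "card (\<Pi>\<inverse> `` {signed_copy (-1) j}) = n" if j: "j \<in> J" for j
  proof -
    have "\<Pi>\<inverse> `` {signed_copy (-1) j}
        = insert None (signed_copy 1 ` (R\<inverse> `` {j}) \<union> signed_copy (-1) ` (\<Gamma>m\<inverse> `` {j}))"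
      by (rule eqI) (use sub GJ R j in \<open>auto simp: mem Ip Im\<close>)
    moreover have "None \<notin> signed_copy 1 ` (R\<inverse> `` {j}) \<union> signed_copy (-1) ` (\<Gamma>m\<inverse> `` {j})"
      by auto
    ultimately show ?thesis
      using tournament_on_degrees[OF assms(4) j] cols[OF j] assms(2) fins
      by (simp add: card_signed_copies)
  qed
  have disj: "None \<notin> Iplus" "None \<notin> Iminus" "Iplus \<inter> Iminus = {}"
    unfolding Ip Im by auto
  have tour: "tournament_on ?I \<Pi>"
    unfolding tournament_on_def
  proof (intro conjI ballI impI)
    show "finite ?I" using assms(1) unfolding Ip Im by simp
    show "\<Pi> \<subseteq> ?I \<times> ?I" by (rule sub)
    show "irrefl \<Pi>"
    proof (rule irreflI)
      fix x
      have "(i, i) \<notin> \<Gamma>p" "(i, i) \<notin> \<Gamma>m" for i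
        using assms(3,4) unfolding tournament_on_def irrefl_def by auto
      then show "(x, x) \<notin> \<Pi>" using vertex_cases[of x] sub mem by blast
    qed
    fix x y assume xy: "x \<in> ?I" "y \<in> ?I" "x \<noteq> y"
    show "((x, y) \<in> \<Pi>) \<noteq> ((y, x) \<in> \<Pi>)"
      \<comment> \<open>Only pairs of equal sign rely on \<open>\<Gamma>p\<close> or
        \<open>\<Gamma>m\<close> being tournaments; cross pairs and pairs with \<open>None\<close>
        are settled by the construction.\<close>
      using vertex_cases[OF xy(1)] vertex_cases[OF xy(2)] xy(3)
      by (elim disjE bexE)
        ((simp add: mem; fail)
          | (simp add: mem, metis tournament_on_flip_iff[OF assms(3)] tournament_on_flip_iff[OF assms(4)]))+
  qed
  have "card ?I = 2 * n + 1"
    using disj cards card_signed_copies[OF assms(1,1)] assms(1,2) unfolding Ip Im by simp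
  moreover have "\<forall>x\<in>?I. card (\<Pi> `` {x}) = n \<and> card (\<Pi>\<inverse> `` {x}) = n"
    using out0 in0 cards outp inp outm inm unfolding Ip Im by auto
  ultimately have "pointed_game_on None Iplus Iminus \<Pi>"
    unfolding pointed_game_on_def game_on_def using tour disj out0 in0 by blast
  moreover have "restrict_rel \<Pi> Iminus = map_prod (signed_copy (-1)) (signed_copy (-1)) ` \<Gamma>m"
    "restrict_rel \<Pi> Iplus = map_prod (signed_copy 1) (signed_copy 1) ` \<Gamma>p"
    using GJ unfolding restrict_rel_def \<Pi>_def Ip Im by auto
  ultimately show ?thesis by blast
qed

end
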